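(* For all $\varepsilon,\delta\in(0,1)$ there is an $L$ such that for all integers $\ell\ge m\ge1$ with $\ell\ge L$, all $\alpha\in(0,1]$, and all integers $$0\le t\le (1-\delta)\,\frac{\ell^2\left(\ell-\frac12\right)\left(m-\frac12\right)}{\alpha\pi^2}\,\log(\ell m),$$ the grid shuffling Markov chain on the $\ell\times m$ grid with move probability $\alpha$ has, after $t$ steps and from a worst starting state, variation distance at least $1-\varepsilon$ from the uniform distribution. This holds both for the chain on arrangements of $\ell m$ distinct cards and for the chain on arrangements of $\lfloor \ell m/2\rfloor$ ones and $\ell m-\lfloor \ell m/2\rfloor$ zeros.
   Context: The $\ell\times m$ grid graph has vertices $(i,j)$, $1\le i\le\ell$, $1\le j\le m$, with edges between vertices at Euclidean distance 1. Each vertex carries one card: either all cards are distinct (the state is a bijection between cards and vertices), or there are $\lfloor \ell m/2\rfloor$ cards labeled 1 and the rest are labeled 0. At each step, with probability $\alpha$ a uniformly random edge of the grid is chosen and the cards at its endpoints are exchanged; with probability $1-\alpha$ nothing happens. The uniform distribution is stationary. Variation distance is total variation distance $\frac12\|\cdot\|_1$. $\log$ is the natural logarithm. *)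

theory Defs
  imports "HOL-Probability.Probability"
begin

definition grid_vertices :: "nat \<Rightarrow> nat \<Rightarrow> (nat \<times> nat) set" where
  "grid_vertices l m = {1..l} \<times> {1..m}"

(* The distance on nat \<times> nat is the library's product metric, i.e. the Euclidean distance. *)
definition grid_edges :: "nat \<Rightarrow> nat \<Rightarrow> (nat \<times> nat) set set" where
  "grid_edges l m =
     {{u, v} | u v. u \<in> grid_vertices l m \<and> v \<in> grid_vertices l m \<and> dist u v = 1}"

(* A state assigns a card to each vertex; it is extensional (undefined off the grid), so that
   the two state spaces below are finite sets whose elements are determined on the grid. *)
definition distinct_arrangements :: "nat \<Rightarrow> nat \<Rightarrow> (nat \<times> nat \<Rightarrow> nat) set" where
  "distinct_arrangements l m =
     {s \<in> extensional (grid_vertices l m). bij_betw s (grid_vertices l m) {1..l * m}}"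

definition zero_one_arrangements :: "nat \<Rightarrow> nat \<Rightarrow> (nat \<times> nat \<Rightarrow> nat) set" where
  "zero_one_arrangements l m =
     {s \<in> grid_vertices l m \<rightarrow>\<^sub>E {0, 1}. card {v \<in> grid_vertices l m. s v = 1} = l * m div 2}"

(* For a two-element set e, the_elem (e - {w}) is the endpoint of e other than w. *)
definition exchange :: "'v set \<Rightarrow> ('v \<Rightarrow> 'c) \<Rightarrow> 'v \<Rightarrow> 'c" where
  "exchange e s = (\<lambda>w. if w \<in> e then s (the_elem (e - {w})) else s w)"

lemma exchange_doubleton:
  assumes "u \<noteq> v"
  shows "exchange {u, v} s = s(u := s v, v := s u)"
proof
  fix w
  have "{u, v} - {u} = {v}" "{u, v} - {v} = {u}" using assms by auto
  then show "exchange {u, v} s w = (s(u := s v, v := s u)) w"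
    by (auto simp: exchange_def)
qed

(* On the 1 \<times> 1 grid there are no edges and pmf_of_set is applied to the empty set,
   so the step is meaningful only for l * m \<ge> 2. *)
definition grid_step ::
    "nat \<Rightarrow> nat \<Rightarrow> real \<Rightarrow> (nat \<times> nat \<Rightarrow> nat) \<Rightarrow> (nat \<times> nat \<Rightarrow> nat) pmf" where
  "grid_step l m \<alpha> s =
     bind_pmf (bernoulli_pmf \<alpha>)
       (\<lambda>move. if move then map_pmf (\<lambda>e. exchange e s) (pmf_of_set (grid_edges l m))
               else return_pmf s)"

primrec grid_chain ::
    "nat \<Rightarrow> nat \<Rightarrow> real \<Rightarrow> nat \<Rightarrow> (nat \<times> nat \<Rightarrow> nat) \<Rightarrow> (nat \<times> nat \<Rightarrow> nat) pmf" where
  "grid_chain l m \<alpha> 0 s = return_pmf s"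
| "grid_chain l m \<alpha> (Suc t) s = bind_pmf (grid_chain l m \<alpha> t s) (grid_step l m \<alpha>)"

definition variation_distance :: "'a pmf \<Rightarrow> 'a pmf \<Rightarrow> real" where
  "variation_distance p q = (\<Sum>\<^sub>\<infinity>x. \<bar>pmf p x - pmf q x\<bar>) / 2"

definition worst_distance ::
    "(nat \<times> nat \<Rightarrow> nat) set \<Rightarrow> nat \<Rightarrow> nat \<Rightarrow> real \<Rightarrow> nat \<Rightarrow> real" where
  "worst_distance \<Omega> l m \<alpha> t =
     (MAX s\<in>\<Omega>. variation_distance (grid_chain l m \<alpha> t s) (pmf_of_set \<Omega>))"

end

theory Submission
  imports Defs
begin

text \<open>Wilson's method. Put \<open>\<Phi>(s) = \<Sum> cos ((x - 1/2) \<pi> / l)\<close>, summed over the vertices \<open>(x, y)\<close>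
  that carry a black card: a card labelled 1, or one of the \<open>l m div 2\<close> smallest cards if all are
  distinct. The cosine is a Neumann eigenfunction of the discrete Laplacian, so one step multiplies
  the mean of \<open>\<Phi>\<close> by \<open>1 - \<lambda>\<close>, where \<open>\<lambda> = \<alpha> (2 - 2 cos (\<pi> / l)) / |E|\<close>. A vertical move leaves \<open>\<Phi>\<close>
  unchanged and a horizontal one changes \<open>\<Phi>\<^sup>2\<close> little enough for the variance to stay below
  \<open>l m / 2\<close> forever; exchanges preserve the uniform distribution, so the same recursion bounds the
  stationary second moment by \<open>l m / 2\<close>. As long as the mean \<open>(1 - \<lambda>)\<^sup>t \<Phi>(s)\<close>, with
  \<open>\<Phi>(s) \<ge> l m / 12\<close> for a suitable start, is much larger than \<open>sqrt (l m)\<close>, Chebyshev's inequality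
  separates the two distributions of \<open>\<Phi>\<close>. The time scale of the theorem comes from
  \<open>(l - 1/2) (m - 1/2) = |E| / 2 + 1/4\<close> and \<open>2 - 2 cos (\<pi> / l) \<le> \<pi>\<^sup>2 / l\<^sup>2\<close>.\<close>

section \<open>The edges of the grid\<close>

lemma finite_grid_vertices [simp]: "finite (grid_vertices l m)"
  by (simp add: grid_vertices_def)

text \<open>Each edge is named by its endpoint with the smaller coordinates, so that sums over edges
  become double sums over index ranges.\<close>

definition horizontal_edge :: "nat \<times> nat \<Rightarrow> (nat \<times> nat) set" where
  "horizontal_edge = (\<lambda>(i, j). {(i, j), (Suc i, j)})"

definition vertical_edge :: "nat \<times> nat \<Rightarrow> (nat \<times> nat) set" where
  "vertical_edge = (\<lambda>(i, j). {(i, j), (i, Suc j)})"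

text \<open>The squared distance is a sum of two integer squares, and such a sum is 1 only if one
  square is 1 and the other is 0.\<close>

lemma dist_grid_eq_1_iff:
  fixes a b c d :: nat
  shows "dist (real a, real b) (real c, real d) = 1 \<longleftrightarrow>
    (b = d \<and> (c = Suc a \<or> a = Suc c)) \<or> (a = c \<and> (d = Suc b \<or> b = Suc d))"
proof -
  define x y where "x = \<bar>int a - int c\<bar>" and "y = \<bar>int b - int d\<bar>"
  have xy: "x \<ge> 0" "y \<ge> 0" by (simp_all add: x_def y_def)
  have "dist (real a, real b) (real c, real d) = sqrt (of_int (x\<^sup>2 + y\<^sup>2))"
    by (simp add: dist_prod_def dist_real_def x_def y_def)
  also have "\<dots> = 1 \<longleftrightarrow> x\<^sup>2 + y\<^sup>2 = 1"
    by (simp only: real_sqrt_eq_1_iff of_int_eq_1_iff)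
  also have "\<dots> \<longleftrightarrow> (x = 1 \<and> y = 0) \<or> (x = 0 \<and> y = 1)"
  proof
    assume eq: "x\<^sup>2 + y\<^sup>2 = 1"
    have "x \<le> x\<^sup>2" "y \<le> y\<^sup>2"
      using xy by (auto simp: power2_eq_square mult_le_cancel_left1)
    then have "x + y \<le> 1" using eq by linarith
    then have "(x = 1 \<and> y = 0) \<or> (x = 0 \<and> y = 1) \<or> (x = 0 \<and> y = 0)" using xy by linarith
    then show "(x = 1 \<and> y = 0) \<or> (x = 0 \<and> y = 1)" using eq by auto
  qed auto
  also have "\<dots> \<longleftrightarrow> (b = d \<and> (c = Suc a \<or> a = Suc c)) \<or> (a = c \<and> (d = Suc b \<or> b = Suc d))"
    by (auto simp: x_def y_def)
  finally show ?thesis .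
qed

lemma grid_edges_eq:
  "grid_edges l m =
     horizontal_edge ` ({1..<l} \<times> {1..m}) \<union> vertical_edge ` ({1..l} \<times> {1..<m})"
proof (intro equalityI subsetI)
  fix e assume "e \<in> grid_edges l m"
  then obtain a b c d where e: "e = {(a, b), (c, d)}" and
    v: "a \<in> {1..l}" "b \<in> {1..m}" "c \<in> {1..l}" "d \<in> {1..m}" and d: "dist (real a, real b) (real c, real d) = 1"
    by (auto simp: grid_edges_def grid_vertices_def)
  from d consider "b = d" "c = Suc a" | "b = d" "a = Suc c" | "a = c" "d = Suc b" | "a = c" "b = Suc d"
    unfolding dist_grid_eq_1_iff by blast
  then show "e \<in> horizontal_edge ` ({1..<l} \<times> {1..m}) \<union> vertical_edge ` ({1..l} \<times> {1..<m})"
  proof cases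
    case 1
    then have "e = horizontal_edge (a, b)" "(a, b) \<in> {1..<l} \<times> {1..m}"
      using e v by (auto simp: horizontal_edge_def)
    then show ?thesis by blast
  next
    case 2
    then have "e = horizontal_edge (c, d)" "(c, d) \<in> {1..<l} \<times> {1..m}"
      using e v by (auto simp: horizontal_edge_def)
    then show ?thesis by blast
  next
    case 3
    then have "e = vertical_edge (a, b)" "(a, b) \<in> {1..l} \<times> {1..<m}"
      using e v by (auto simp: vertical_edge_def)
    then show ?thesis by blast
  next
    case 4
    then have "e = vertical_edge (c, d)" "(c, d) \<in> {1..l} \<times> {1..<m}"
      using e v by (auto simp: vertical_edge_def)
    then show ?thesis by blast
  qed
next
  fix e assume "e \<in> horizontal_edge ` ({1..<l} \<times> {1..m}) \<union> vertical_edge ` ({1..l} \<times> {1..<m})"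
  then obtain i j i' j' where "e = {(i, j), (i', j')}"
    "dist (real i, real j) (real i', real j') = 1" "i \<in> {1..l}" "j \<in> {1..m}" "i' \<in> {1..l}" "j' \<in> {1..m}"
  proof
    assume "e \<in> horizontal_edge ` ({1..<l} \<times> {1..m})"
    then obtain i j where "i \<in> {1..<l}" "j \<in> {1..m}" "e = {(i, j), (Suc i, j)}"
      by (auto simp: horizontal_edge_def)
    moreover have "dist (real i, real j) (real (Suc i), real j) = 1"
      by (simp only: dist_grid_eq_1_iff) simp
    ultimately show ?thesis by (intro that[of i j "Suc i" j]) auto
  next
    assume "e \<in> vertical_edge ` ({1..l} \<times> {1..<m})"
    then obtain i j where "i \<in> {1..l}" "j \<in> {1..<m}" "e = {(i, j), (i, Suc j)}"
      by (auto simp: vertical_edge_def)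
    moreover have "dist (real i, real j) (real i, real (Suc j)) = 1"
      by (simp only: dist_grid_eq_1_iff) simp
    ultimately show ?thesis by (intro that[of i j i "Suc j"]) auto
  qed
  then show "e \<in> grid_edges l m"
    unfolding grid_edges_def
    by (intro CollectI exI[of _ "(i, j)"] exI[of _ "(i', j')"]) (simp add: grid_vertices_def)
qed

lemma finite_grid_edges [simp]: "finite (grid_edges l m)"
  by (simp add: grid_edges_eq)

text \<open>Two equal unordered pairs that do not match in order must match crosswise, which would
  make each first coordinate the successor of the other.\<close>

lemma inj_horizontal_edge: "inj_on horizontal_edge A"
proof (rule inj_onI)
  fix p q assume "horizontal_edge p = horizontal_edge q"
  then have "p = q \<or> (fst p = Suc (fst q) \<and> Suc (fst p) = fst q)"
    unfolding horizontal_edge_def doubleton_eq_iff split_def prod_eq_iff fst_conv snd_conv by blast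
  moreover have "\<not> (fst p = Suc (fst q) \<and> Suc (fst p) = fst q)" by presburger
  ultimately show "p = q" by blast
qed

lemma inj_vertical_edge: "inj_on vertical_edge A"
proof (rule inj_onI)
  fix p q assume "vertical_edge p = vertical_edge q"
  then have "p = q \<or> (snd p = Suc (snd q) \<and> Suc (snd p) = snd q)"
    unfolding vertical_edge_def doubleton_eq_iff split_def prod_eq_iff fst_conv snd_conv by blast
  moreover have "\<not> (snd p = Suc (snd q) \<and> Suc (snd p) = snd q)" by presburger
  ultimately show "p = q" by blast
qed

lemma horizontal_vertical_disjoint: "horizontal_edge ` A \<inter> vertical_edge ` B = {}"
proof -
  have "horizontal_edge p \<noteq> vertical_edge q" for p q
  proof
    assume "horizontal_edge p = vertical_edge q"
    then have "fst p = fst q \<and> Suc (fst p) = fst q"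
      unfolding horizontal_edge_def vertical_edge_def doubleton_eq_iff split_def prod_eq_iff
        fst_conv snd_conv by blast
    then show False by presburger
  qed
  then show ?thesis by blast
qed

text \<open>The codomain is any commutative monoid because the same splitting serves to count edges
  and to sum real increments. In the horizontal part the row index is outermost: the Laplacian will
  act along each row.\<close>

lemma sum_grid_edges:
  fixes G :: "(nat \<times> nat) set \<Rightarrow> 'a::comm_monoid_add"
  shows "sum G (grid_edges l m) =
    (\<Sum>j=1..m. \<Sum>i=1..<l. G {(i, j), (Suc i, j)}) + (\<Sum>i=1..l. \<Sum>j=1..<m. G {(i, j), (i, Suc j)})"
proof -
  have "sum G (grid_edges l m) = (\<Sum>p\<in>{1..<l} \<times> {1..m}. G (horizontal_edge p))
      + (\<Sum>p\<in>{1..l} \<times> {1..<m}. G (vertical_edge p))"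
    unfolding grid_edges_eq
    by (subst sum.union_disjoint)
      (simp_all add: horizontal_vertical_disjoint sum.reindex inj_horizontal_edge inj_vertical_edge)
  moreover have "(\<Sum>p\<in>{1..<l} \<times> {1..m}. G (horizontal_edge p)) =
      (\<Sum>j=1..m. \<Sum>i=1..<l. G {(i, j), (Suc i, j)})"
    by (subst sum.swap) (simp add: sum.cartesian_product horizontal_edge_def split_def)
  moreover have "(\<Sum>p\<in>{1..l} \<times> {1..<m}. G (vertical_edge p)) =
      (\<Sum>i=1..l. \<Sum>j=1..<m. G {(i, j), (i, Suc j)})"
    unfolding sum.cartesian_product by (simp add: vertical_edge_def split_def)
  ultimately show ?thesis by simp
qed

lemma card_grid_edges:
  assumes "l \<ge> 1" "m \<ge> 1"
  shows "real (card (grid_edges l m)) = 2 * real l * real m - real l - real m"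
proof -
  have "card (grid_edges l m) = m * (l - 1) + l * (m - 1)"
    unfolding card_eq_sum sum_grid_edges by simp
  then have "real (card (grid_edges l m)) = real m * real (l - 1) + real l * real (m - 1)"
    by simp
  then show ?thesis
    using assms by (simp add: of_nat_diff algebra_simps)
qed

lemma grid_edgeE:
  assumes "e \<in> grid_edges l m"
  obtains u v where "e = {u, v}" "u \<noteq> v" "u \<in> grid_vertices l m" "v \<in> grid_vertices l m"
proof -
  from assms obtain u v where "e = {u, v}" "u \<in> grid_vertices l m" "v \<in> grid_vertices l m"
    "dist (real (fst u), real (snd u)) (real (fst v), real (snd v)) = 1"
    by (auto simp: grid_edges_def)
  then show ?thesis by (intro that[of u v]) auto
qed

section \<open>The cosine profile as an eigenfunction of the discrete Laplacian\<close>

definition profile :: "nat \<Rightarrow> nat \<times> nat \<Rightarrow> real" where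
  "profile l v = cos ((2 * real (fst v) - 1) * (pi / (2 * real l)))"

text \<open>This is \<open>\<Phi>\<close> with a general weight \<open>w\<close> on cards; taking
  for \<open>w\<close> the indicator of the black cards covers both state spaces at once.\<close>

definition statistic :: "nat \<Rightarrow> nat \<Rightarrow> ('c \<Rightarrow> real) \<Rightarrow> (nat \<times> nat \<Rightarrow> 'c) \<Rightarrow> real" where
  "statistic l m w s = (\<Sum>v\<in>grid_vertices l m. profile l v * w (s v))"

lemma statistic_exchange:
  assumes "u \<noteq> v" "u \<in> grid_vertices l m" "v \<in> grid_vertices l m"
  shows "statistic l m w (exchange {u, v} s) =
    statistic l m w s - (profile l u - profile l v) * (w (s u) - w (s v))"
proof -
  define R where "R = grid_vertices l m - {u, v}"
  have R: "grid_vertices l m = insert u (insert v R)" "u \<notin> insert v R" "v \<notin> R" "finite R"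
    using assms by (auto simp: R_def)
  have "(\<Sum>x\<in>R. profile l x * w (exchange {u, v} s x)) = (\<Sum>x\<in>R. profile l x * w (s x))"
    by (intro sum.cong refl) (auto simp: R_def exchange_def)
  then show ?thesis
    unfolding statistic_def R(1) exchange_doubleton[OF assms(1)] using R(2-) assms(1)
    by (simp add: algebra_simps)
qed

text \<open>For \<open>l \<ge> 2\<close> this is the smallest positive eigenvalue of the Neumann
  Laplacian on a path with \<open>l\<close> vertices.\<close>

definition gap :: "nat \<Rightarrow> real" where
  "gap l = 2 - 2 * cos (pi / real l)"

lemma gap_eq: "gap l = 4 * (sin (pi / (2 * real l)))\<^sup>2"
  using cos_double_sin[of "pi / (2 * real l)"] by (simp add: gap_def)

lemma gap_nonneg: "gap l \<ge> 0"
  by (simp add: gap_eq)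

text \<open>The product form shows that the difference, read as a function of \<open>i\<close>,
  vanishes at \<open>i = 0\<close> and \<open>i = l\<close>. The rows may differ because the profile
  depends on the column only.\<close>

lemma profile_diff:
  "profile l (i, j) - profile l (Suc i, j') =
     2 * sin (pi / (2 * real l)) * sin (2 * real i * (pi / (2 * real l)))"
proof -
  define h where "h = pi / (2 * real l)"
  have "profile l (i, j) - profile l (Suc i, j') =
      cos ((2 * real i - 1) * h) - cos ((2 * real i + 1) * h)"
    by (simp add: profile_def h_def algebra_simps)
  also have "\<dots> = 2 * sin (((2 * real i - 1) * h + (2 * real i + 1) * h) / 2) *
     sin (((2 * real i + 1) * h - (2 * real i - 1) * h) / 2)"
    by (rule cos_diff_cos)
  also have "((2 * real i - 1) * h + (2 * real i + 1) * h) / 2 = 2 * real i * h"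
    by (simp add: field_simps)
  also have "((2 * real i + 1) * h - (2 * real i - 1) * h) / 2 = h"
    by (simp add: field_simps)
  finally show ?thesis by (simp add: h_def)
qed

text \<open>Abel summation with both boundary terms kept. The conditional makes these terms cancel
  at \<open>n = 0\<close>, where the left side is empty, so that the induction can start
  there.\<close>

lemma summation_by_parts:
  fixes d g :: "nat \<Rightarrow> real"
  shows "(\<Sum>i=1..<Suc n. g i * (d i - d (i - 1))) =
    (\<Sum>i=1..<n. d i * (g i - g (Suc i))) + d n * g n - d 0 * (if n = 0 then g 0 else g 1)"
proof (induction n)
  case (Suc n)
  then show ?case by (cases n) (simp_all add: algebra_simps)
qed simp

text \<open>Summation by parts moves the difference from \<open>g\<close> to the profile, whose
  second difference is \<open>gap l\<close> times the profile itself.\<close>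

lemma profile_discrete_laplacian:
  fixes g :: "nat \<Rightarrow> real"
  assumes "l \<ge> 1"
  shows "(\<Sum>i=1..<l. (profile l (i, j) - profile l (Suc i, j)) * (g i - g (Suc i))) =
    gap l * (\<Sum>i=1..l. profile l (i, j) * g i)"
proof -
  define h where "h = pi / (2 * real l)"
  \<comment> \<open>\<open>d i\<close> is the drop of the profile from column \<open>i\<close> to
    column \<open>i + 1\<close>. It is zero at both ends, which is the Neumann condition, so no
    boundary term survives.\<close>
  define d where "d i = 2 * sin h * sin (2 * real i * h)" for i :: nat
  have d0: "d 0 = 0" by (simp add: d_def)
  have dl: "d l = 0" using assms by (simp add: d_def h_def)
  have d: "d i - d (i - 1) = gap l * profile l (i, j)" if "i \<ge> 1" for i
  proof -
    have "d i - d (i - 1) = 2 * sin h * (sin (2 * real i * h) - sin (2 * (real i - 1) * h))"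
      using that by (simp add: d_def of_nat_diff algebra_simps)
    also have "sin (2 * real i * h) - sin (2 * (real i - 1) * h) =
        2 * sin ((2 * real i * h - 2 * (real i - 1) * h) / 2) *
          cos ((2 * real i * h + 2 * (real i - 1) * h) / 2)"
      by (rule sin_diff_sin)
    also have "(2 * real i * h - 2 * (real i - 1) * h) / 2 = h" by (simp add: algebra_simps)
    also have "(2 * real i * h + 2 * (real i - 1) * h) / 2 = (2 * real i - 1) * h"
      by (simp add: field_simps)
    finally show ?thesis
      by (simp add: gap_eq profile_def h_def power2_eq_square)
  qed
  have "(\<Sum>i=1..<l. (profile l (i, j) - profile l (Suc i, j)) * (g i - g (Suc i))) =
      (\<Sum>i=1..<l. d i * (g i - g (Suc i)))"
    by (simp add: profile_diff d_def h_def)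
  also have "\<dots> = (\<Sum>i=1..<Suc l. g i * (d i - d (i - 1)))"
    by (simp only: summation_by_parts d0 dl)
  also have "\<dots> = (\<Sum>i=1..<Suc l. gap l * (profile l (i, j) * g i))"
    using d by (intro sum.cong refl) auto
  finally show ?thesis
    by (simp add: sum_distrib_left atLeastLessThanSuc_atLeastAtMost)
qed

text \<open>Exchanges inside a column do not change the statistic, and those along one row add up to
  minus the Laplacian form of that row.\<close>

lemma sum_edges_statistic:
  assumes "l \<ge> 1"
  shows "(\<Sum>e\<in>grid_edges l m. statistic l m w (exchange e s) - statistic l m w s) =
    - gap l * statistic l m w s"
proof -
  have hor: "statistic l m w (exchange {(i, j), (Suc i, j)} s) - statistic l m w s =
      - ((profile l (i, j) - profile l (Suc i, j)) * (w (s (i, j)) - w (s (Suc i, j))))"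
    if "i \<in> {1..<l}" "j \<in> {1..m}" for i j
    using that by (subst statistic_exchange) (auto simp: grid_vertices_def)
  have ver: "statistic l m w (exchange {(i, j), (i, Suc j)} s) - statistic l m w s = 0"
    if "i \<in> {1..l}" "j \<in> {1..<m}" for i j
    using that by (subst statistic_exchange) (auto simp: grid_vertices_def profile_def)
  have "(\<Sum>e\<in>grid_edges l m. statistic l m w (exchange e s) - statistic l m w s) =
      (\<Sum>j=1..m. \<Sum>i=1..<l. - ((profile l (i, j) - profile l (Suc i, j)) * (w (s (i, j)) - w (s (Suc i, j)))))"
    unfolding sum_grid_edges using hor ver by simp
  also have "\<dots> = (\<Sum>j=1..m. - (gap l * (\<Sum>i=1..l. profile l (i, j) * w (s (i, j)))))"
    using profile_discrete_laplacian[OF assms] by (intro sum.cong refl) (simp add: sum_negf)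
  also have "\<dots> = - gap l * (\<Sum>j=1..m. \<Sum>i=1..l. profile l (i, j) * w (s (i, j)))"
    by (simp add: sum_distrib_left sum_negf)
  also have "(\<Sum>j=1..m. \<Sum>i=1..l. profile l (i, j) * w (s (i, j))) = statistic l m w s"
    unfolding statistic_def grid_vertices_def by (subst sum.swap) (simp add: sum.cartesian_product split_def)
  finally show ?thesis .
qed

text \<open>The bound carries the same factor \<open>gap l\<close> as the drift; in the
  second-moment recursion the two cancel.\<close>

lemma profile_diff_square_le: "(profile l (i, j) - profile l (Suc i, j'))\<^sup>2 \<le> gap l"
proof -
  have "(sin (2 * real i * (pi / (2 * real l))))\<^sup>2 \<le> 1"
    by (simp add: abs_square_le_1)
  then show ?thesis
    using mult_left_mono[of _ 1 "gap l"] gap_nonneg[of l]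
    by (simp add: profile_diff gap_eq power_mult_distrib)
qed

lemma gap_le: "gap l \<le> pi\<^sup>2 / (real l)\<^sup>2"
proof -
  have "\<bar>sin (pi / (2 * real l))\<bar> \<le> \<bar>pi / (2 * real l)\<bar>" by (rule abs_sin_x_le_abs_x)
  then have "(sin (pi / (2 * real l)))\<^sup>2 \<le> (pi / (2 * real l))\<^sup>2" by (rule abs_le_square_iff[THEN iffD1])
  then show ?thesis by (simp add: gap_eq power_divide power_mult_distrib)
qed

lemma gap_pos:
  assumes "l \<ge> 1"
  shows "gap l > 0"
proof -
  have "sin (pi / (2 * real l)) > 0"
    using assms by (intro sin_gt_zero) (auto simp: field_simps)
  then show ?thesis by (simp add: gap_eq)
qed

text \<open>Only the \<open>(l - 1) m\<close> horizontal edges contribute, each at most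
  \<open>gap l\<close>.\<close>

lemma sum_edges_statistic_diff_square_le:
  assumes w: "\<And>a b. \<bar>w a - w b\<bar> \<le> 1"
  shows "(\<Sum>e\<in>grid_edges l m. (statistic l m w (exchange e s) - statistic l m w s)\<^sup>2) \<le>
    gap l * (real l * real m)"
proof -
  have hor: "(statistic l m w (exchange {(i, j), (Suc i, j)} s) - statistic l m w s)\<^sup>2 \<le> gap l"
    if "i \<in> {1..<l}" "j \<in> {1..m}" for i j
  proof -
    have "(statistic l m w (exchange {(i, j), (Suc i, j)} s) - statistic l m w s)\<^sup>2 =
      (profile l (i, j) - profile l (Suc i, j))\<^sup>2 * (w (s (i, j)) - w (s (Suc i, j)))\<^sup>2"
      using that by (subst statistic_exchange) (auto simp: grid_vertices_def power_mult_distrib)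
    also have "\<dots> \<le> gap l * 1"
      using w by (intro mult_mono profile_diff_square_le gap_nonneg) (auto simp: abs_square_le_1)
    finally show ?thesis by simp
  qed
  have ver: "statistic l m w (exchange {(i, j), (i, Suc j)} s) - statistic l m w s = 0"
    if "i \<in> {1..l}" "j \<in> {1..<m}" for i j
    using that by (subst statistic_exchange) (auto simp: grid_vertices_def profile_def)
  have "(\<Sum>e\<in>grid_edges l m. (statistic l m w (exchange e s) - statistic l m w s)\<^sup>2) =
    (\<Sum>j=1..m. \<Sum>i=1..<l. (statistic l m w (exchange {(i, j), (Suc i, j)} s) - statistic l m w s)\<^sup>2)"
    unfolding sum_grid_edges using ver by simp
  also have "\<dots> \<le> (\<Sum>j=1..m. \<Sum>i=1..<l. gap l)"
    by (intro sum_mono hor)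
  also have "\<dots> = gap l * (real (l - 1) * real m)" by simp
  also have "\<dots> \<le> gap l * (real l * real m)"
    by (intro mult_left_mono mult_right_mono gap_nonneg) auto
  finally show ?thesis .
qed

section \<open>Expectations under the chain and a lower bound on variation distance\<close>

lemma finite_set_grid_step:
  assumes "grid_edges l m \<noteq> {}"
  shows "finite (set_pmf (grid_step l m \<alpha> s))"
  using assms by (auto simp: grid_step_def)

text \<open>In this form the holding probability merely scales the mean increment over the edges by
  \<open>\<alpha>\<close>.\<close>

lemma expectation_grid_step:
  fixes F :: "(nat \<times> nat \<Rightarrow> nat) \<Rightarrow> real"
  assumes "grid_edges l m \<noteq> {}" "0 \<le> \<alpha>" "\<alpha> \<le> 1"
  shows "measure_pmf.expectation (grid_step l m \<alpha> s) F =
    F s + \<alpha> / card (grid_edges l m) * (\<Sum>e\<in>grid_edges l m. F (exchange e s) - F s)"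
proof -
  have "measure_pmf.expectation (grid_step l m \<alpha> s) F =
      \<alpha> * ((\<Sum>e\<in>grid_edges l m. F (exchange e s)) / card (grid_edges l m)) + (1 - \<alpha>) * F s"
    unfolding grid_step_def
    by (subst pmf_expectation_bind[where A = UNIV])
      (use assms in \<open>auto simp: UNIV_bool integral_pmf_of_set\<close>)
  then show ?thesis
    using assms by (simp add: sum_subtractf card_gt_0_iff field_simps)
qed

lemma finite_set_grid_chain:
  assumes "grid_edges l m \<noteq> {}"
  shows "finite (set_pmf (grid_chain l m \<alpha> t s))"
  by (induction t) (use assms in \<open>auto simp: finite_set_grid_step\<close>)

lemma expectation_bind_finite:
  fixes F :: "'b \<Rightarrow> real"
  assumes "finite (set_pmf p)" "\<And>x. finite (set_pmf (K x))"
  shows "measure_pmf.expectation (bind_pmf p K) F =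
    measure_pmf.expectation p (\<lambda>x. measure_pmf.expectation (K x) F)"
  using assms by (simp add: pmf_expectation_bind[of "set_pmf p"] integral_measure_pmf[of "set_pmf p"])

text \<open>The difference \<open>D\<close> of the two mass functions has total sum 0, so its sum
  over \<open>A\<close> is minus its sum over the complement. Adding the two estimates counts every
  point once, which accounts for the factor 1/2.\<close>

lemma measure_diff_le_variation_distance:
  fixes p q :: "'a pmf"
  assumes fin: "finite (set_pmf p)" "finite (set_pmf q)"
  shows "measure_pmf.prob p A - measure_pmf.prob q A \<le> variation_distance p q"
proof -
  define S where "S = set_pmf p \<union> set_pmf q"
  have S: "finite S" "set_pmf p \<subseteq> S" "set_pmf q \<subseteq> S" using fin by (auto simp: S_def)
  have out: "pmf p x = 0" "pmf q x = 0" if "x \<notin> S" for x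
    using that by (auto simp: S_def set_pmf_iff)
  have "(\<Sum>\<^sub>\<infinity>x. \<bar>pmf p x - pmf q x\<bar>) = (\<Sum>\<^sub>\<infinity>x\<in>S. \<bar>pmf p x - pmf q x\<bar>)"
    by (rule infsum_cong_neutral) (auto simp: out)
  then have vd: "2 * variation_distance p q = (\<Sum>x\<in>S. \<bar>pmf p x - pmf q x\<bar>)"
    using S(1) by (simp add: variation_distance_def)
  have prob: "measure_pmf.prob r A = sum (pmf r) (S \<inter> A)" if "\<And>x. x \<notin> S \<Longrightarrow> pmf r x = 0" for r
  proof -
    have "measure_pmf.prob r A = measure_pmf.prob r (S \<inter> A)"
      by (rule measure_prob_cong_0) (auto intro: that)
    also have "\<dots> = sum (pmf r) (S \<inter> A)"
      by (rule measure_measure_pmf_finite) (simp add: S)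
    finally show ?thesis .
  qed
  have split: "sum g S = sum g (S \<inter> A) + sum g (S - A)" for g :: "'a \<Rightarrow> real"
    using S(1) by (rule sum.Int_Diff)
  define D N where "D x = pmf p x - pmf q x" and "N x = \<bar>pmf p x - pmf q x\<bar>" for x
  have "sum D S = 0"
    using sum_pmf_eq_1[OF S(1,2)] sum_pmf_eq_1[OF S(1,3)] by (simp add: D_def sum_subtractf)
  moreover have "measure_pmf.prob p A - measure_pmf.prob q A = sum D (S \<inter> A)"
    by (simp add: prob out D_def sum_subtractf)
  moreover have "sum D (S \<inter> A) \<le> sum N (S \<inter> A)"
    by (intro sum_mono) (simp add: D_def N_def)
  moreover have "- sum D (S - A) \<le> sum N (S - A)"
    unfolding sum_negf[symmetric] by (intro sum_mono) (simp add: D_def N_def)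
  ultimately have "2 * measure_pmf.prob p A - 2 * measure_pmf.prob q A \<le> sum N S"
    using split[of D] split[of N] by linarith
  then show ?thesis
    unfolding N_def vd[symmetric] by simp
qed

text \<open>The test event is that \<open>F\<close> exceeds \<open>\<mu> / 2\<close>. Chebyshev's
  inequality under \<open>p\<close> and the second moment under \<open>q\<close> each cost at most
  \<open>4 * V / \<mu>\<^sup>2\<close>.\<close>

lemma variation_distance_ge_moments:
  fixes p q :: "'a pmf" and F :: "'a \<Rightarrow> real"
  assumes fin: "finite (set_pmf p)" "finite (set_pmf q)"
    and \<mu>: "measure_pmf.expectation p F = \<mu>" "\<mu> > 0"
    and var: "measure_pmf.variance p F \<le> V"
    and sq: "measure_pmf.expectation q (\<lambda>x. (F x)\<^sup>2) \<le> V"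
  shows "variation_distance p q \<ge> 1 - 8 * V / \<mu>\<^sup>2"
proof -
  define A where "A = {x. F x > \<mu> / 2}"
  have int: "integrable (measure_pmf p) G" "integrable (measure_pmf q) G" for G :: "'a \<Rightarrow> real"
    using fin by (auto intro: integrable_measure_pmf_finite)
  have "measure_pmf.prob p (- A) \<le> measure_pmf.prob p {x \<in> space p. \<mu> / 2 \<le> \<bar>F x - measure_pmf.expectation p F\<bar>}"
  proof (intro measure_pmf.finite_measure_mono subsetI)
    fix x assume "x \<in> - A"
    then have "F x \<le> \<mu> / 2" by (simp add: A_def)
    then have "\<mu> / 2 \<le> \<bar>F x - \<mu>\<bar>" by linarith
    then show "x \<in> {x \<in> space p. \<mu> / 2 \<le> \<bar>F x - measure_pmf.expectation p F\<bar>}"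
      by (simp add: \<mu>(1))
  qed simp
  also have "\<dots> \<le> measure_pmf.variance p F / (\<mu> / 2)\<^sup>2"
    by (intro measure_pmf.Chebyshev_inequality int) (use \<mu>(2) in auto)
  also have "\<dots> \<le> V / (\<mu> / 2)\<^sup>2"
    using var by (intro divide_right_mono) auto
  finally have p: "measure_pmf.prob p A \<ge> 1 - V / (\<mu> / 2)\<^sup>2"
    using measure_pmf.prob_compl[of A p] by (simp add: Compl_eq_Diff_UNIV)
  have "measure_pmf.prob q A \<le> measure_pmf.prob q {x \<in> space q. \<mu> / 2 \<le> \<bar>F x\<bar>}"
    by (intro measure_pmf.finite_measure_mono) (auto simp: A_def)
  also have "\<dots> \<le> measure_pmf.expectation q (\<lambda>x. (F x)\<^sup>2) / (\<mu> / 2)\<^sup>2"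
    by (intro measure_pmf.second_moment_method int) (use \<mu>(2) in auto)
  also have "\<dots> \<le> V / (\<mu> / 2)\<^sup>2"
    using sq by (intro divide_right_mono) auto
  finally have "1 - 2 * (V / (\<mu> / 2)\<^sup>2) \<le> measure_pmf.prob p A - measure_pmf.prob q A"
    using p by linarith
  also have "\<dots> \<le> variation_distance p q"
    by (rule measure_diff_le_variation_distance[OF fin])
  finally show ?thesis by (simp add: power_divide)
qed

section \<open>Exchanges act on the state spaces and preserve the uniform distribution\<close>

lemma exchange_exchange:
  assumes "u \<noteq> v"
  shows "exchange {u, v} (exchange {u, v} s) = s"
  using assms by (auto simp: exchange_doubleton)

lemma exchange_eq_transpose:
  assumes "u \<noteq> v"
  shows "exchange {u, v} s = s \<circ> Transposition.transpose u v"
  using assms by (auto simp: exchange_doubleton fun_eq_iff Transposition.transpose_def)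

text \<open>Since exchanges along edges are involutions, closure already makes each of them a
  permutation of the state space.\<close>

definition exchange_closed :: "nat \<Rightarrow> nat \<Rightarrow> (nat \<times> nat \<Rightarrow> 'c) set \<Rightarrow> bool" where
  "exchange_closed l m \<Omega> \<longleftrightarrow> (\<forall>e\<in>grid_edges l m. \<forall>s\<in>\<Omega>. exchange e s \<in> \<Omega>)"

lemma sum_exchange:
  fixes F :: "(nat \<times> nat \<Rightarrow> 'c) \<Rightarrow> real"
  assumes "exchange_closed l m \<Omega>" "e \<in> grid_edges l m"
  shows "(\<Sum>s\<in>\<Omega>. F (exchange e s)) = (\<Sum>s\<in>\<Omega>. F s)"
proof -
  obtain u v where "e = {u, v}" "u \<noteq> v" using grid_edgeE[OF assms(2)] by metis
  then show ?thesis using assms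
    by (intro sum.reindex_bij_witness[of _ "exchange e" "exchange e"])
      (auto simp: exchange_exchange exchange_closed_def)
qed

text \<open>Stationarity in weak form: for each edge separately, the increments of \<open>F\<close>
  summed over all states cancel.\<close>

lemma expectation_uniform_grid_step:
  fixes F :: "(nat \<times> nat \<Rightarrow> nat) \<Rightarrow> real"
  assumes \<Omega>: "exchange_closed l m \<Omega>" "finite \<Omega>" "\<Omega> \<noteq> {}"
    and "grid_edges l m \<noteq> {}" "0 \<le> \<alpha>" "\<alpha> \<le> 1"
  shows "measure_pmf.expectation (pmf_of_set \<Omega>) (\<lambda>s. measure_pmf.expectation (grid_step l m \<alpha> s) F) =
    measure_pmf.expectation (pmf_of_set \<Omega>) F"
proof -
  have "(\<Sum>s\<in>\<Omega>. \<Sum>e\<in>grid_edges l m. F (exchange e s) - F s) =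
      (\<Sum>e\<in>grid_edges l m. (\<Sum>s\<in>\<Omega>. F (exchange e s)) - (\<Sum>s\<in>\<Omega>. F s))"
    by (subst sum.swap) (simp add: sum_subtractf)
  also have "\<dots> = 0" using sum_exchange[OF \<Omega>(1)] by simp
  finally show ?thesis
    using assms by (simp add: expectation_grid_step integral_pmf_of_set sum.distrib
        flip: sum_distrib_left sum_divide_distrib)
qed

lemma exchange_closed_distinct_arrangements: "exchange_closed l m (distinct_arrangements l m)"
  unfolding exchange_closed_def
proof (intro ballI)
  fix e s assume "e \<in> grid_edges l m" and s: "s \<in> distinct_arrangements l m"
  then obtain u v where uv: "e = {u, v}" "u \<noteq> v" "u \<in> grid_vertices l m" "v \<in> grid_vertices l m"
    by (elim grid_edgeE)
  have "bij_betw (s \<circ> Transposition.transpose u v) (grid_vertices l m) {1..l * m}"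
    using s uv by (intro bij_betw_trans[of _ _ "grid_vertices l m"]) (auto simp: distinct_arrangements_def)
  moreover have "exchange e s \<in> extensional (grid_vertices l m)"
    using s uv by (auto simp: exchange_doubleton distinct_arrangements_def extensional_def)
  ultimately show "exchange e s \<in> distinct_arrangements l m"
    using uv by (simp add: distinct_arrangements_def exchange_eq_transpose)
qed

text \<open>The transposition maps the positions of the ones after the exchange bijectively to those
  before it, so their number is kept.\<close>

lemma exchange_closed_zero_one_arrangements: "exchange_closed l m (zero_one_arrangements l m)"
  unfolding exchange_closed_def
proof (intro ballI)
  fix e s assume "e \<in> grid_edges l m" and s: "s \<in> zero_one_arrangements l m"
  then obtain u v where uv: "e = {u, v}" "u \<noteq> v" "u \<in> grid_vertices l m" "v \<in> grid_vertices l m"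
    by (elim grid_edgeE)
  have "bij_betw (Transposition.transpose u v) {x \<in> grid_vertices l m. (s \<circ> Transposition.transpose u v) x = 1}
      {x \<in> grid_vertices l m. s x = 1}"
    using uv by (intro bij_betw_byWitness[of _ "Transposition.transpose u v"]) (auto simp: Transposition.transpose_def)
  then have "card {x \<in> grid_vertices l m. exchange e s x = 1} = l * m div 2"
    using s uv by (auto simp: zero_one_arrangements_def exchange_eq_transpose dest: bij_betw_same_card)
  moreover have "exchange e s \<in> grid_vertices l m \<rightarrow>\<^sub>E {0, 1}"
  proof (rule PiE_I)
    have cards: "s x \<in> {0, 1}" if "x \<in> grid_vertices l m" for x
      using s that unfolding zero_one_arrangements_def by blast
    show "exchange e s x \<in> {0, 1}" if "x \<in> grid_vertices l m" for x
      using cards[OF that] cards[OF uv(3)] cards[OF uv(4)] uv(1,2)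
      by (simp add: exchange_doubleton)
    show "exchange e s x = undefined" if "x \<notin> grid_vertices l m" for x
      using s uv that by (auto simp: exchange_doubleton zero_one_arrangements_def)
  qed
  ultimately show "exchange e s \<in> zero_one_arrangements l m"
    by (simp add: zero_one_arrangements_def)
qed

lemma finite_distinct_arrangements: "finite (distinct_arrangements l m)"
proof (rule finite_subset)
  show "distinct_arrangements l m \<subseteq> grid_vertices l m \<rightarrow>\<^sub>E {1..l * m}"
    by (auto simp: distinct_arrangements_def PiE_def bij_betw_def)
qed (simp add: finite_PiE)

lemma finite_zero_one_arrangements: "finite (zero_one_arrangements l m)"
proof (rule finite_subset)
  show "zero_one_arrangements l m \<subseteq> grid_vertices l m \<rightarrow>\<^sub>E {0, 1}"
    by (auto simp: zero_one_arrangements_def)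
qed (simp add: finite_PiE)

section \<open>Starting states with a large statistic\<close>

lemma card_grid_vertices [simp]: "card (grid_vertices l m) = l * m"
  by (simp add: grid_vertices_def)

text \<open>The black cards fill the left half of the grid, where the cosine is nonnegative; the
  columns up to \<open>l div 3\<close>, at least \<open>l / 6\<close> of them, contribute at least
  1/2 per vertex.\<close>

lemma exists_half_with_large_profile:
  assumes l: "l \<ge> 3"
  obtains A where "A \<subseteq> grid_vertices l m" "card A = l * m div 2"
    "(\<Sum>v\<in>A. profile l v) \<ge> real l * real m / 12"
proof -
  \<comment> \<open>For odd \<open>l\<close> the set \<open>A\<close> has to take part of the middle
    column, so it is squeezed between the left half without that column and the left half with
    it.\<close>
  have half: "(l div 2) * m \<le> l * m div 2" "l * m div 2 \<le> ((l + 1) div 2) * m"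
  proof -
    have "(2 * (l div 2)) * m \<le> l * m" by (intro mult_right_mono) auto
    then have "2 * ((l div 2) * m) \<le> l * m" by (simp only: mult.assoc)
    then show "(l div 2) * m \<le> l * m div 2" by linarith
    have "l * m \<le> (2 * ((l + 1) div 2)) * m" by (intro mult_right_mono) auto
    then have "l * m \<le> 2 * (((l + 1) div 2) * m)" by (simp only: mult.assoc)
    then show "l * m div 2 \<le> ((l + 1) div 2) * m" by linarith
  qed
  define B C where "B = {1..l div 2} \<times> {1..m}" and "C = {1..(l + 1) div 2} \<times> {1..m}"
  have "card B \<le> l * m div 2" "l * m div 2 \<le> card C" "B \<subseteq> C" "finite C"
    using half by (auto simp: B_def C_def)
  from exists_subset_between[OF this] obtain A
    where A: "{1..l div 2} \<times> {1..m} \<subseteq> A" "A \<subseteq> {1..(l + 1) div 2} \<times> {1..m}" "card A = l * m div 2"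
    unfolding B_def C_def by blast
  have finA: "finite A" using A(2) finite_subset by blast
  have A_bounds: "1 \<le> fst v" "fst v \<le> (l + 1) div 2" "1 \<le> snd v" "snd v \<le> m" if "v \<in> A" for v
    using subsetD[OF A(2) that] by (simp_all add: mem_Times_iff)
  have A_sub: "A \<subseteq> grid_vertices l m"
  proof
    fix v assume "v \<in> A"
    from A_bounds[OF this] l show "v \<in> grid_vertices l m"
      by (simp add: grid_vertices_def mem_Times_iff)
  qed
  \<comment> \<open>Even in the middle column the angle does not exceed
    \<open>pi / 2\<close>.\<close>
  have nonneg: "profile l v \<ge> 0" if "v \<in> A" for v
  proof -
    have v: "1 \<le> fst v" "2 * fst v \<le> l + 1" using A_bounds[OF that] by simp_all
    have "(2 * real (fst v) - 1) * (pi / (2 * real l)) \<le> real l * (pi / (2 * real l))"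
      using v by (intro mult_right_mono) auto
    also have "\<dots> = pi / 2" using l by simp
    finally show ?thesis
      unfolding profile_def using v by (intro cos_ge_zero order_trans[OF _ mult_nonneg_nonneg]) auto
  qed
  have large: "profile l v \<ge> 1 / 2" if "v \<in> {1..l div 3} \<times> {1..m}" for v
  proof -
    have v: "1 \<le> fst v" "3 * fst v \<le> l" using that by auto
    have "(2 * real (fst v) - 1) * (pi / (2 * real l)) \<le> (2 * real l / 3) * (pi / (2 * real l))"
      using v by (intro mult_right_mono) auto
    also have "\<dots> = pi / 3" using l by simp
    finally have "cos (pi / 3) \<le> profile l v"
      unfolding profile_def using v by (intro cos_monotone_0_pi_le mult_nonneg_nonneg) auto
    then show ?thesis by (simp add: cos_60)
  qed
  have "l \<le> 6 * (l div 3)" using l by presburger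
  then have "real l * real m / 12 \<le> real (6 * (l div 3)) * real m / 12"
    by (intro divide_right_mono mult_right_mono of_nat_mono) auto
  also have "\<dots> = (\<Sum>v\<in>{1..l div 3} \<times> {1..m}. 1 / 2)" by simp
  also have "\<dots> \<le> (\<Sum>v\<in>{1..l div 3} \<times> {1..m}. profile l v)"
    by (intro sum_mono large)
  also have "\<dots> \<le> (\<Sum>v\<in>A. profile l v)"
  proof (intro sum_mono2 finA)
    have "l div 3 \<le> l div 2" by (simp add: div_le_mono2)
    then have "{1..l div 3} \<times> {1..m} \<subseteq> {1..l div 2} \<times> {1..m}" by auto
    then show "{1..l div 3} \<times> {1..m} \<subseteq> A" using A(1) by blast
  qed (auto intro: nonneg)
  finally show ?thesis using that A_sub A(3) by blast
qed

lemma statistic_of_bool: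
  "statistic l m (\<lambda>c. of_bool (P c)) s = (\<Sum>v\<in>{v \<in> grid_vertices l m. P (s v)}. profile l v)"
  unfolding statistic_def sum.inter_filter[OF finite_grid_vertices] by (intro sum.cong) auto

lemma exists_zero_one_arrangement:
  assumes "l \<ge> 3"
  obtains s where "s \<in> zero_one_arrangements l m"
    "statistic l m (\<lambda>c. of_bool (c = 1)) s \<ge> real l * real m / 12"
proof -
  obtain A where A: "A \<subseteq> grid_vertices l m" "card A = l * m div 2"
    "(\<Sum>v\<in>A. profile l v) \<ge> real l * real m / 12"
    using exists_half_with_large_profile[OF assms] .
  define s :: "nat \<times> nat \<Rightarrow> nat" where "s = restrict (\<lambda>v. of_bool (v \<in> A)) (grid_vertices l m)"
  have eq: "{v \<in> grid_vertices l m. s v = 1} = A"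
    using A(1) by (auto simp: s_def split: if_splits)
  then have "s \<in> zero_one_arrangements l m"
    using A(2) by (auto simp: zero_one_arrangements_def s_def)
  moreover have "statistic l m (\<lambda>c. of_bool (c = 1)) s \<ge> real l * real m / 12"
    unfolding statistic_of_bool eq by (rule A(3))
  ultimately show ?thesis using that by blast
qed

text \<open>The statistic sees only which vertices hold low labels, so any bijection of
  \<open>A\<close> onto the low labels and any of its complement onto the high ones will do.\<close>

lemma exists_distinct_arrangement:
  assumes "l \<ge> 3"
  obtains s where "s \<in> distinct_arrangements l m"
    "statistic l m (\<lambda>c. of_bool (c \<le> l * m div 2)) s \<ge> real l * real m / 12"
proof -
  define k where "k = l * m div 2"
  obtain A where A: "A \<subseteq> grid_vertices l m" "card A = k"
    "(\<Sum>v\<in>A. profile l v) \<ge> real l * real m / 12"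
    using exists_half_with_large_profile[OF assms] unfolding k_def .
  have finA: "finite A" using A(1) finite_subset finite_grid_vertices by blast
  obtain f where f: "bij_betw f A {1..k}"
    using finite_same_card_bij[of A "{1..k}"] finA A(2) by auto
  obtain g where g: "bij_betw g (grid_vertices l m - A) {k + 1..l * m}"
    using finite_same_card_bij[of "grid_vertices l m - A" "{k + 1..l * m}"] finA A(1,2)
    by (auto simp: card_Diff_subset)
  define s where "s = restrict (\<lambda>v. if v \<in> A then f v else g v) (grid_vertices l m)"
  have "bij_betw s A {1..k}"
    using f by (rule bij_betw_cong[THEN iffD1, rotated]) (use A(1) in \<open>auto simp: s_def\<close>)
  moreover have "bij_betw s (grid_vertices l m - A) {k + 1..l * m}"
    using g by (rule bij_betw_cong[THEN iffD1, rotated]) (auto simp: s_def)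
  ultimately have "bij_betw s (A \<union> (grid_vertices l m - A)) ({1..k} \<union> {k + 1..l * m})"
    by (rule bij_betw_combine) auto
  moreover have "A \<union> (grid_vertices l m - A) = grid_vertices l m" using A(1) by blast
  moreover have "{1..k} \<union> {k + 1..l * m} = {1..l * m}" by (auto simp: k_def)
  ultimately have "s \<in> distinct_arrangements l m"
    by (simp add: distinct_arrangements_def s_def)
  moreover have eq: "{v \<in> grid_vertices l m. s v \<le> k} = A"
  proof -
    have "f v \<le> k" if "v \<in> A" for v
      using bij_betwE[OF f] that by auto
    moreover have "\<not> g v \<le> k" if "v \<in> grid_vertices l m - A" for v
    proof -
      have "g v \<in> {k + 1..l * m}" using bij_betwE[OF g] that by blast
      then show ?thesis by simp
    qed
    ultimately show ?thesis using A(1) by (auto simp: s_def split: if_splits)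
  qed
  moreover have "statistic l m (\<lambda>c. of_bool (c \<le> k)) s \<ge> real l * real m / 12"
    unfolding statistic_of_bool eq by (rule A(3))
  ultimately show ?thesis using that unfolding k_def by blast
qed

section \<open>The decay rate and the time scale\<close>

context
  fixes l m :: nat and \<alpha> :: real
  assumes m: "m \<ge> 1" and l: "l \<ge> 2" and \<alpha>: "0 < \<alpha>" "\<alpha> \<le> 1"
begin

definition decay :: real where
  "decay = \<alpha> * gap l / card (grid_edges l m)"

text \<open>Two columns provide a horizontal edge even if \<open>m = 1\<close>; hence the uniform
  choice of an edge is meaningful.\<close>

lemma edges_nonempty: "grid_edges l m \<noteq> {}"
proof -
  have "horizontal_edge (1, 1) \<in> grid_edges l m"
    using m l by (auto simp: grid_edges_eq)
  then show ?thesis by blast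
qed

lemma decay_pos: "decay > 0"
  unfolding decay_def using \<alpha> gap_pos[of l] l edges_nonempty
  by (simp add: card_gt_0_iff)

lemma decay_le: "decay * card (grid_edges l m) \<le> \<alpha> * (pi\<^sup>2 / (real l)\<^sup>2)"
  using mult_left_mono[OF gap_le[of l], of \<alpha>] \<alpha> edges_nonempty
  by (simp add: decay_def card_gt_0_iff)

text \<open>With \<open>n = l m\<close>, the time bound gives
  \<open>2 t decay \<le> (1 - \<delta>) ln n\<close> up to a relative error from the edge count.
  This error and the one from replacing \<open>ln (1 - decay)\<close> by a linear bound fit into a
  factor \<open>1 + \<delta>\<close>, so the power is at least \<open>n\<close> to the exponent
  \<open>\<delta>\<^sup>2 - 1\<close>.\<close>

lemma power_decay_ge:
  assumes \<delta>: "0 < \<delta>" "\<delta> < 1" and large: "64 / \<delta> \<le> real l"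
    and t: "real t \<le> (1 - \<delta>) * ((real l ^ 2 * (real l - 1 / 2) * (real m - 1 / 2)) / (\<alpha> * pi ^ 2))
              * ln (real l * real m)"
  shows "2 * decay \<le> 1" "(1 - decay) ^ (2 * t) * (real l * real m) \<ge> exp (\<delta>\<^sup>2 * ln (real l))"
proof -
  define E where "E = real (card (grid_edges l m))"
  have E: "E = 2 * real l * real m - real l - real m"
    unfolding E_def using l m by (intro card_grid_edges) auto
  have "real l * 1 \<le> real l * real m" "1 * real m \<le> real l * real m"
    using m l by (intro mult_mono; simp)+
  moreover have "(real l - 1) * (real m - 1) \<ge> 0" using l m by simp
  \<comment> \<open>\<open>E\<close> equals \<open>(l - 1) (m - 1) + (l m - 1)\<close>.\<close>
  ultimately have "E \<ge> real l - 1"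
    unfolding E by (simp add: algebra_simps)
  moreover have l64: "real l \<ge> 64" "real l \<ge> 2 / \<delta> + 1"
  proof -
    have "64 \<le> 64 / \<delta>" using \<delta> by (simp add: field_simps)
    then show "real l \<ge> 64" using large by simp
    have "2 / \<delta> + 1 \<le> 64 / \<delta>" using \<delta> by (simp add: field_simps)
    then show "real l \<ge> 2 / \<delta> + 1" using large by simp
  qed
  ultimately have E_ge: "E \<ge> 2 / \<delta>" "E \<ge> 1" by auto
  have n: "real l * real m \<ge> real l" "real l * real m > 0" using m l by auto
  have ln_n: "ln (real l * real m) \<ge> 0" using n l64 by (intro ln_ge_zero) linarith
  have decay_E: "decay * E \<le> \<alpha> * (pi\<^sup>2 / (real l)\<^sup>2)" using decay_le by (simp add: E_def)
  \<comment> \<open>The crude bound \<open>16 / l\<close> on \<open>decay\<close> suffices; the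
    constant 64 in the hypothesis turns it into \<open>\<delta> / 4\<close>.\<close>
  have "decay \<le> decay * E" using E_ge decay_pos by simp
  also have "\<dots> \<le> 1 * (4\<^sup>2 / (real l)\<^sup>2)"
    using pi_less_4 \<alpha> by (intro order_trans[OF decay_E] mult_mono divide_right_mono power_mono) auto
  also have "\<dots> = 16 / real l / real l" by (simp add: power2_eq_square)
  also have "\<dots> \<le> 16 / real l / 1" using l64 by (intro divide_left_mono) auto
  also have "\<dots> \<le> \<delta> / 4" using large \<delta> l64 by (simp add: field_simps)
  finally have decay_small: "decay \<le> \<delta> / 4" .
  then show "2 * decay \<le> 1" using \<delta> by simp
  have pos: "1 - decay > 0" using decay_small \<delta> by simp
  have "decay \<le> \<alpha> * (pi\<^sup>2 / (real l)\<^sup>2) / E"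
    using decay_E E_ge by (subst pos_le_divide_eq) auto
  then have "2 * (real t * decay) \<le> 2 * ((1 - \<delta>) * (((real l)\<^sup>2 * (real l - 1 / 2) * (real m - 1 / 2)) / (\<alpha> * pi\<^sup>2))
      * ln (real l * real m) * (\<alpha> * (pi\<^sup>2 / (real l)\<^sup>2) / E))"
    using t decay_pos by (intro mult_left_mono mult_mono') auto
  also have "\<dots> = (1 - \<delta>) * (2 * ((real l - 1 / 2) * (real m - 1 / 2)) / E) * ln (real l * real m)"
  proof -
    have "2 * (c * ((real l)\<^sup>2 * x * y / (\<alpha> * pi\<^sup>2)) * z * (\<alpha> * (pi\<^sup>2 / (real l)\<^sup>2) / E)) =
        c * (2 * (x * y) / E) * z" for c x y z
      using \<alpha> l by simp
    then show ?thesis .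
  qed
  \<comment> \<open>The shifts by 1/2 in the time scale make the product match the number of edges
    up to a constant.\<close>
  also have "2 * ((real l - 1 / 2) * (real m - 1 / 2)) / E = 1 + 1 / (2 * E)"
  proof -
    have "2 * ((real l - 1 / 2) * (real m - 1 / 2)) = E + 1 / 2"
      unfolding E by (simp add: field_simps)
    then show ?thesis using E_ge by (simp add: field_simps)
  qed
  finally have t_decay: "2 * (real t * decay) \<le> (1 - \<delta>) * (1 + 1 / (2 * E)) * ln (real l * real m)" .
  \<comment> \<open>Both errors are at most \<open>\<delta> / 4\<close>; together with the factor
    \<open>1 - \<delta>\<close>, the allowance \<open>1 + \<delta>\<close> yields
    \<open>1 - \<delta>\<^sup>2\<close>.\<close>
  have "1 / (2 * E) \<le> \<delta> / 4" using E_ge \<delta> by (simp add: field_simps)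
  then have "1 + 1 / (2 * E) \<le> 1 + \<delta> / 4" by simp
  also have "\<dots> \<le> (1 + \<delta>) * (1 - \<delta> / 4)"
  proof -
    have "\<delta> * \<delta> \<le> \<delta> * 2" using \<delta> by (intro mult_left_mono) auto
    then show ?thesis by (simp add: field_simps)
  qed
  also have "\<dots> \<le> (1 + \<delta>) * (1 - decay)"
    using decay_small \<delta> by (intro mult_left_mono) auto
  finally have "(1 - \<delta>) * (1 + 1 / (2 * E)) * ln (real l * real m) \<le>
      (1 - \<delta>) * ((1 + \<delta>) * (1 - decay)) * ln (real l * real m)"
    using \<delta> ln_n by (intro mult_right_mono mult_left_mono) auto
  with t_decay have "2 * (real t * decay) \<le> (1 - \<delta>\<^sup>2) * ln (real l * real m) * (1 - decay)"
    by (simp add: power2_eq_square algebra_simps)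
  then have t_bound: "2 * (real t * decay) / (1 - decay) \<le> (1 - \<delta>\<^sup>2) * ln (real l * real m)"
    using pos by (simp add: pos_divide_le_eq)
  \<comment> \<open>Applying \<open>ln x \<le> x - 1\<close> to the reciprocal gives a lower bound
    for \<open>ln (1 - decay)\<close>.\<close>
  have "ln (1 / (1 - decay)) \<le> 1 / (1 - decay) - 1"
    using pos by (intro ln_le_minus_one) auto
  also have "\<dots> = decay / (1 - decay)" using pos by (simp add: field_simps)
  finally have "- (decay / (1 - decay)) \<le> ln (1 - decay)"
    using pos by (simp add: ln_div)
  then have "real (2 * t) * - (decay / (1 - decay)) \<le> real (2 * t) * ln (1 - decay)"
    by (rule mult_left_mono) simp
  then have "- ((1 - \<delta>\<^sup>2) * ln (real l * real m)) \<le> real (2 * t) * ln (1 - decay)"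
    using t_bound by simp
  then have "exp (- ((1 - \<delta>\<^sup>2) * ln (real l * real m))) \<le> exp (real (2 * t) * ln (1 - decay))"
    by simp
  also have "\<dots> = (1 - decay) ^ (2 * t)"
    using pos by (subst exp_of_nat_mult) simp
  finally have "exp (- ((1 - \<delta>\<^sup>2) * ln (real l * real m))) * exp (ln (real l * real m)) \<le>
      (1 - decay) ^ (2 * t) * (real l * real m)"
    using n by (simp add: mult_right_mono del: exp_ln_iff)
  moreover have "exp (- ((1 - \<delta>\<^sup>2) * ln (real l * real m))) * exp (ln (real l * real m)) =
      exp (\<delta>\<^sup>2 * ln (real l * real m))"
    by (simp only: exp_add[symmetric]) (simp add: algebra_simps)
  \<comment> \<open>Passing from \<open>l m\<close> to \<open>l\<close> makes the final bound
    uniform in \<open>m\<close>.\<close>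
  moreover have "exp (\<delta>\<^sup>2 * ln (real l)) \<le> exp (\<delta>\<^sup>2 * ln (real l * real m))"
    using n l by (simp add: mult_left_mono)
  ultimately show "(1 - decay) ^ (2 * t) * (real l * real m) \<ge> exp (\<delta>\<^sup>2 * ln (real l))"
    by linarith
qed

section \<open>Recursions for the first two moments\<close>

lemma expectation_chain_Suc:
  fixes F :: "(nat \<times> nat \<Rightarrow> nat) \<Rightarrow> real"
  shows "measure_pmf.expectation (grid_chain l m \<alpha> (Suc t) s) F =
    measure_pmf.expectation (grid_chain l m \<alpha> t s) (\<lambda>x. measure_pmf.expectation (grid_step l m \<alpha> x) F)"
  by (simp add: expectation_bind_finite finite_set_grid_chain finite_set_grid_step edges_nonempty)

lemma integrable_chain:
  fixes F :: "(nat \<times> nat \<Rightarrow> nat) \<Rightarrow> real"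
  shows "integrable (measure_pmf (grid_chain l m \<alpha> t s)) F"
  by (intro integrable_measure_pmf_finite finite_set_grid_chain edges_nonempty)

context
  fixes w :: "nat \<Rightarrow> real"
  assumes w: "\<And>a b. \<bar>w a - w b\<bar> \<le> 1"
begin

lemma expectation_step_statistic:
  "measure_pmf.expectation (grid_step l m \<alpha> s) (statistic l m w) = (1 - decay) * statistic l m w s"
  using \<alpha> l edges_nonempty
  by (simp add: expectation_grid_step sum_edges_statistic decay_def algebra_simps)

text \<open>The increment of a square is a cross term plus the squared increment: the cross term
  averages to \<open>- 2 * decay\<close> times the square, and the rest is at most
  \<open>decay * l * m\<close>.\<close>

lemma expectation_step_statistic_square_le:
  "measure_pmf.expectation (grid_step l m \<alpha> s) (\<lambda>s. (statistic l m w s)\<^sup>2) \<le>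
     (1 - 2 * decay) * (statistic l m w s)\<^sup>2 + decay * (real l * real m)"
proof -
  define \<Delta> where "\<Delta> e = statistic l m w (exchange e s) - statistic l m w s" for e
  define c where "c = \<alpha> / card (grid_edges l m)"
  have c: "c \<ge> 0" using \<alpha> by (simp add: c_def)
  have "(statistic l m w (exchange e s))\<^sup>2 - (statistic l m w s)\<^sup>2 =
      2 * statistic l m w s * \<Delta> e + (\<Delta> e)\<^sup>2" for e
    by (simp add: \<Delta>_def power2_eq_square algebra_simps)
  then have "(\<Sum>e\<in>grid_edges l m. (statistic l m w (exchange e s))\<^sup>2 - (statistic l m w s)\<^sup>2) =
      2 * statistic l m w s * (\<Sum>e\<in>grid_edges l m. \<Delta> e) + (\<Sum>e\<in>grid_edges l m. (\<Delta> e)\<^sup>2)"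
    by (simp add: sum.distrib sum_distrib_left)
  also have "\<dots> \<le> 2 * statistic l m w s * (- gap l * statistic l m w s) + gap l * (real l * real m)"
    unfolding \<Delta>_def using sum_edges_statistic_diff_square_le[of w, OF w] l
    by (simp add: sum_edges_statistic)
  finally have "c * (\<Sum>e\<in>grid_edges l m. (statistic l m w (exchange e s))\<^sup>2 - (statistic l m w s)\<^sup>2) \<le>
      c * (2 * statistic l m w s * (- gap l * statistic l m w s) + gap l * (real l * real m))"
    by (rule mult_left_mono[OF _ c])
  also have "\<dots> = - 2 * decay * (statistic l m w s)\<^sup>2 + decay * (real l * real m)"
    by (simp add: decay_def c_def power2_eq_square algebra_simps)
  finally show ?thesis
    using \<alpha> edges_nonempty by (simp add: expectation_grid_step c_def algebra_simps)
qed

lemma expectation_chain_statistic: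
  "measure_pmf.expectation (grid_chain l m \<alpha> t s) (statistic l m w) =
     (1 - decay) ^ t * statistic l m w s"
proof (induction t)
  case (Suc t)
  have "measure_pmf.expectation (grid_chain l m \<alpha> (Suc t) s) (statistic l m w) =
      measure_pmf.expectation (grid_chain l m \<alpha> t s) (\<lambda>x. (1 - decay) * statistic l m w x)"
    unfolding expectation_chain_Suc expectation_step_statistic ..
  also have "\<dots> = (1 - decay) * measure_pmf.expectation (grid_chain l m \<alpha> t s) (statistic l m w)"
    by (rule integral_mult_right_zero)
  finally show ?case by (simp add: Suc.IH mult.assoc del: grid_chain.simps)
qed simp

text \<open>The additive term \<open>l m / 2\<close> is the fixed point of the one-step recursion;
  the assumption keeps its coefficient nonnegative, so that the induction hypothesis can be
  inserted.\<close>

lemma expectation_chain_statistic_square_le: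
  assumes "2 * decay \<le> 1"
  shows "measure_pmf.expectation (grid_chain l m \<alpha> t s) (\<lambda>s. (statistic l m w s)\<^sup>2) \<le>
    (1 - 2 * decay) ^ t * (statistic l m w s)\<^sup>2 + real l * real m / 2"
proof (induction t)
  case (Suc t)
  let ?E = "measure_pmf.expectation (grid_chain l m \<alpha> t s)"
  have "measure_pmf.expectation (grid_chain l m \<alpha> (Suc t) s) (\<lambda>s. (statistic l m w s)\<^sup>2) \<le>
      ?E (\<lambda>x. (1 - 2 * decay) * (statistic l m w x)\<^sup>2 + decay * (real l * real m))"
    unfolding expectation_chain_Suc
    by (rule integral_mono[OF integrable_chain integrable_chain expectation_step_statistic_square_le])
  also have "\<dots> = (1 - 2 * decay) * ?E (\<lambda>x. (statistic l m w x)\<^sup>2) + decay * (real l * real m)"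
    by (simp add: integrable_chain)
  also have "\<dots> \<le> (1 - 2 * decay) * ((1 - 2 * decay) ^ t * (statistic l m w s)\<^sup>2 + real l * real m / 2)
       + decay * (real l * real m)"
    using Suc assms by (intro add_right_mono mult_left_mono) auto
  also have "\<dots> = (1 - 2 * decay) ^ Suc t * (statistic l m w s)\<^sup>2 + real l * real m / 2"
    by (simp add: algebra_simps)
  finally show ?case .
qed simp

text \<open>Since \<open>1 - 2 * decay \<le> (1 - decay)\<^sup>2\<close>, the squared mean absorbs
  the term that depends on the starting state, and the bound is uniform in \<open>t\<close>.\<close>

lemma variance_chain_statistic_le:
  assumes "2 * decay \<le> 1"
  shows "measure_pmf.variance (grid_chain l m \<alpha> t s) (statistic l m w) \<le> real l * real m / 2"
proof -
  have "measure_pmf.variance (grid_chain l m \<alpha> t s) (statistic l m w) =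
      measure_pmf.expectation (grid_chain l m \<alpha> t s) (\<lambda>s. (statistic l m w s)\<^sup>2)
        - ((1 - decay) ^ t * statistic l m w s)\<^sup>2"
    by (subst measure_pmf.variance_eq) (simp_all add: integrable_chain expectation_chain_statistic)
  also have "\<dots> \<le> (1 - 2 * decay) ^ t * (statistic l m w s)\<^sup>2 + real l * real m / 2
      - ((1 - decay)\<^sup>2) ^ t * (statistic l m w s)\<^sup>2"
    using expectation_chain_statistic_square_le[OF assms]
    by (simp add: power_mult_distrib power_mult[symmetric] mult.commute)
  also have "\<dots> \<le> real l * real m / 2"
  proof -
    have "1 - 2 * decay \<le> (1 - decay)\<^sup>2" by (simp add: power2_eq_square algebra_simps)
    then have "(1 - 2 * decay) ^ t \<le> ((1 - decay)\<^sup>2) ^ t" using assms by (intro power_mono) auto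
    then have "(1 - 2 * decay) ^ t * (statistic l m w s)\<^sup>2 \<le> ((1 - decay)\<^sup>2) ^ t * (statistic l m w s)\<^sup>2"
      by (rule mult_right_mono) simp
    then show ?thesis by simp
  qed
  finally show ?thesis .
qed

text \<open>By stationarity the second moment bounds itself through one step of the recursion, and
  dividing by \<open>decay > 0\<close> solves for it.\<close>

lemma expectation_uniform_statistic_square_le:
  assumes \<Omega>: "exchange_closed l m \<Omega>" "finite \<Omega>" "\<Omega> \<noteq> {}"
  shows "measure_pmf.expectation (pmf_of_set \<Omega>) (\<lambda>s. (statistic l m w s)\<^sup>2) \<le> real l * real m / 2"
proof -
  let ?E = "measure_pmf.expectation (pmf_of_set \<Omega>)"
  have int: "integrable (measure_pmf (pmf_of_set \<Omega>)) F" for F :: "(nat \<times> nat \<Rightarrow> nat) \<Rightarrow> real"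
    using \<Omega> by (intro integrable_measure_pmf_finite) auto
  have "?E (\<lambda>s. (statistic l m w s)\<^sup>2) =
      ?E (\<lambda>s. measure_pmf.expectation (grid_step l m \<alpha> s) (\<lambda>s. (statistic l m w s)\<^sup>2))"
    using \<Omega> \<alpha> edges_nonempty by (simp add: expectation_uniform_grid_step)
  also have "\<dots> \<le> ?E (\<lambda>s. (1 - 2 * decay) * (statistic l m w s)\<^sup>2 + decay * (real l * real m))"
    by (rule integral_mono[OF int int expectation_step_statistic_square_le])
  also have "\<dots> = (1 - 2 * decay) * ?E (\<lambda>s. (statistic l m w s)\<^sup>2) + decay * (real l * real m)"
    by (simp add: int)
  finally have "decay * (2 * ?E (\<lambda>s. (statistic l m w s)\<^sup>2)) \<le> decay * (real l * real m)"
    by (simp add: algebra_simps)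
  then show ?thesis using decay_pos by (simp add: mult_le_cancel_left_pos)
qed

lemma worst_distance_ge:
  assumes \<Omega>: "exchange_closed l m \<Omega>" "finite \<Omega>" and s: "s \<in> \<Omega>"
    and start: "statistic l m w s \<ge> real l * real m / 12" and decay: "2 * decay \<le> 1"
  shows "worst_distance \<Omega> l m \<alpha> t \<ge> 1 - 576 / ((1 - decay) ^ (2 * t) * (real l * real m))"
proof -
  have nonempty: "\<Omega> \<noteq> {}" using s by blast
  define n where "n = real l * real m"
  have n: "n > 0" using l m by (simp add: n_def)
  define \<mu> where "\<mu> = (1 - decay) ^ t * statistic l m w s"
  have \<mu>0: "(1 - decay) ^ t * (n / 12) > 0" using n decay decay_pos by simp
  have le: "(1 - decay) ^ t * (n / 12) \<le> \<mu>"
    unfolding \<mu>_def using start decay by (intro mult_left_mono) (auto simp: n_def)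
  then have \<mu>: "\<mu> > 0" using \<mu>0 by linarith
  define c where "c = (1 - decay) ^ (2 * t)"
  have c: "c > 0" unfolding c_def using decay by (intro zero_less_power) simp
  have sq: "((1 - decay) ^ t * (n / 12))\<^sup>2 = c * n * n / 144"
    by (simp add: c_def power2_eq_square mult_2 power_add)
  have "((1 - decay) ^ t * (n / 12))\<^sup>2 \<le> \<mu>\<^sup>2"
    by (rule power_mono[OF le less_imp_le[OF \<mu>0]])
  moreover have "((1 - decay) ^ t * (n / 12))\<^sup>2 > 0"
    using \<mu>0 by (intro zero_less_power)
  ultimately have "8 * (n / 2) / \<mu>\<^sup>2 \<le> 8 * (n / 2) / ((1 - decay) ^ t * (n / 12))\<^sup>2"
    using n by (intro divide_left_mono mult_pos_pos) auto
  \<comment> \<open>With variance bound \<open>n / 2\<close> and start \<open>n / 12\<close> the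
    constant is \<open>8 / 2 * 12\<^sup>2 = 576\<close>.\<close>
  also have "\<dots> = 576 / (c * n)"
    unfolding sq using n c by (simp add: field_simps)
  finally have "1 - 576 / (c * n) \<le> 1 - 8 * (n / 2) / \<mu>\<^sup>2" by simp
  also have "\<dots> \<le> variation_distance (grid_chain l m \<alpha> t s) (pmf_of_set \<Omega>)"
  proof (rule variation_distance_ge_moments)
    show "measure_pmf.expectation (grid_chain l m \<alpha> t s) (statistic l m w) = \<mu>"
      by (simp add: expectation_chain_statistic \<mu>_def)
    show "measure_pmf.variance (grid_chain l m \<alpha> t s) (statistic l m w) \<le> n / 2"
      using variance_chain_statistic_le[OF decay] by (simp add: n_def)
    show "measure_pmf.expectation (pmf_of_set \<Omega>) (\<lambda>s. (statistic l m w s)\<^sup>2) \<le> n / 2"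
      using expectation_uniform_statistic_square_le[OF \<Omega>] s by (auto simp: n_def)
  qed (use \<Omega> nonempty \<mu> in \<open>auto simp: finite_set_grid_chain edges_nonempty\<close>)
  also have "\<dots> \<le> worst_distance \<Omega> l m \<alpha> t"
    unfolding worst_distance_def using \<Omega> s by (intro Max_ge) auto
  finally show ?thesis by (simp add: n_def c_def)
qed

end

end

section \<open>Choice of the threshold and conclusion for both state spaces\<close>

theorem mainTheorem12:
  fixes \<epsilon> \<delta> :: real
  assumes "0 < \<epsilon>" "\<epsilon> < 1" "0 < \<delta>" "\<delta> < 1"
  shows "\<exists>L::nat. \<forall>(l::nat) (m::nat) (\<alpha>::real) (t::nat).
    l \<ge> m \<longrightarrow> m \<ge> 1 \<longrightarrow> l \<ge> L \<longrightarrow> 0 < \<alpha> \<longrightarrow> \<alpha> \<le> 1 \<longrightarrow>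
    real t \<le> (1 - \<delta>) * ((real l ^ 2 * (real l - 1 / 2) * (real m - 1 / 2)) / (\<alpha> * pi ^ 2))
              * ln (real l * real m) \<longrightarrow>
    worst_distance (distinct_arrangements l m) l m \<alpha> t \<ge> 1 - \<epsilon> \<and>
    worst_distance (zero_one_arrangements l m) l m \<alpha> t \<ge> 1 - \<epsilon>"
proof -
  \<comment> \<open>\<open>K\<close> is \<open>576 / \<epsilon>\<close> to the power
    \<open>1 / \<delta>\<^sup>2\<close>, so \<open>l \<ge> K\<close> gives
    \<open>exp (\<delta>\<^sup>2 * ln l) \<ge> 576 / \<epsilon>\<close>.\<close>
  define K where "K = exp (ln (576 / \<epsilon>) / \<delta>\<^sup>2)"
  obtain L :: nat where L: "real L \<ge> max (64 / \<delta>) K" using real_arch_simple by blast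
  show ?thesis
  proof (intro exI[of _ L] allI impI)
    fix l m t :: nat and \<alpha> :: real
    assume m: "m \<ge> 1" and "m \<le> l" and "l \<ge> L" and \<alpha>: "0 < \<alpha>" "\<alpha> \<le> 1"
      and t: "real t \<le> (1 - \<delta>) * ((real l ^ 2 * (real l - 1 / 2) * (real m - 1 / 2)) / (\<alpha> * pi ^ 2))
              * ln (real l * real m)"
    then have large: "64 / \<delta> \<le> real l" "K \<le> real l" using L by auto
    have "64 \<le> 64 / \<delta>" using assms by (simp add: field_simps)
    then have l: "l \<ge> 3" "l \<ge> 2" using large(1) by linarith+
    have "ln (576 / \<epsilon>) / \<delta>\<^sup>2 \<le> ln (real l)"
      using large(2) l by (simp add: K_def ln_ge_iff)
    then have "ln (576 / \<epsilon>) \<le> \<delta>\<^sup>2 * ln (real l)"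
      using assms by (simp add: field_simps)
    then have "576 / \<epsilon> \<le> exp (\<delta>\<^sup>2 * ln (real l))"
      using assms by (simp add: ln_ge_iff flip: ln_le_cancel_iff)
    also have "\<dots> \<le> (1 - decay l m \<alpha>) ^ (2 * t) * (real l * real m)"
      by (rule power_decay_ge(2)[OF m l(2) \<alpha> assms(3,4) large(1) t])
    finally have "576 / ((1 - decay l m \<alpha>) ^ (2 * t) * (real l * real m)) \<le> 576 / (576 / \<epsilon>)"
      using assms by (intro divide_left_mono mult_pos_pos[OF less_le_trans[of 0 "576 / \<epsilon>"]]) auto
    then have \<epsilon>: "1 - \<epsilon> \<le> 1 - 576 / ((1 - decay l m \<alpha>) ^ (2 * t) * (real l * real m))"
      by simp
    have small: "2 * decay l m \<alpha> \<le> 1"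
      by (rule power_decay_ge(1)[OF m l(2) \<alpha> assms(3,4) large(1) t])
    obtain s where s: "s \<in> distinct_arrangements l m"
      "statistic l m (\<lambda>c. of_bool (c \<le> l * m div 2)) s \<ge> real l * real m / 12"
      using exists_distinct_arrangement[OF l(1)] .
    obtain s' where s': "s' \<in> zero_one_arrangements l m"
      "statistic l m (\<lambda>c. of_bool (c = 1)) s' \<ge> real l * real m / 12"
      using exists_zero_one_arrangement[OF l(1)] .
    show "worst_distance (distinct_arrangements l m) l m \<alpha> t \<ge> 1 - \<epsilon> \<and>
      worst_distance (zero_one_arrangements l m) l m \<alpha> t \<ge> 1 - \<epsilon>"
      \<comment> \<open>The premise left open says that the weight oscillates by at most 1, which is
        clear for an indicator.\<close>
      by (intro conjI order_trans[OF \<epsilon>]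
          worst_distance_ge[OF m l(2) \<alpha> _ exchange_closed_distinct_arrangements
            finite_distinct_arrangements s small]
          worst_distance_ge[OF m l(2) \<alpha> _ exchange_closed_zero_one_arrangements
            finite_zero_one_arrangements s' small]) auto
  qed
qed

end
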